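(* Let $(R_i)_{i\in I}$ be a direct system of rings indexed on a directed set $(I,\le)$, with connecting ring morphisms $\mu_{ij}\colon R_i\to R_j$ for $i\le j$. Consider the inverse system of partially ordered sets $(\operatorname{Hom}(R_i))_{i\in I}$ with connecting maps $\operatorname{Hom}(\mu_{ij})\colon\operatorname{Hom}(R_j)\to\operatorname{Hom}(R_i)$ for $i\le j$. Then $$\operatorname{Hom}\Bigl(\varinjlim R_i\Bigr)\cong\varprojlim\operatorname{Hom}(R_i)$$ as partially ordered sets.
   Context: All rings are associative with identity $1\neq 0$ and ring morphisms send $1$ to $1$. $U(S)$ denotes the group of two-sided invertible elements of a ring $S$. For a ring $R$, $\operatorname{Hom}(R)$ denotes the set of all pairs $(\ker(\varphi),\varphi^{-1}(U(S)))$ where $\varphi\colon R\to S$ is a ring morphism into an arbitrary ring $S$, partially ordered by $(\mathfrak a,M)\le(\mathfrak b,N)$ if and only if $\mathfrak a\subseteq\mathfrak b$ and $M\subseteq N$. For a ring morphism $f\colon R\to R'$, the order-preserving map $\operatorname{Hom}(f)\colon\operatorname{Hom}(R')\to\operatorname{Hom}(R)$ is $(\mathfrak a',M')\mapsto(f^{-1}(\mathfrak a'),f^{-1}(M'))$; $\operatorname{Hom}(-)$ is a contravariant functor. The inverse limit of an inverse system of partially ordered sets is the set of compatible families in the product, with the componentwise order. *)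

theory Defs
  imports "HOL-Algebra.Algebra"
begin

section \<open>Rings and the partially ordered set \<open>Hom(R)\<close>\<close>

text \<open>
  The library's \<^locale>\<open>ring\<close> is associative and unital but may be the zero ring;
  \<^const>\<open>ring_hom\<close> preserves the identity and \<^const>\<open>Units\<close> is the group of two-sided
  invertible elements.
\<close>

locale nonzero_ring = ring +
  assumes one_not_zero: "\<one> \<noteq> \<zero>"

definition hom_pair ::
  "('a, 'm) ring_scheme \<Rightarrow> ('b, 'n) ring_scheme \<Rightarrow> ('a \<Rightarrow> 'b) \<Rightarrow> 'a set \<times> 'a set" where
  "hom_pair R S \<phi> = (a_kernel R S \<phi>, {r \<in> carrier R. \<phi> r \<in> Units S})"

text \<open>
  A definition cannot quantify over the type of the elements of \<open>S\<close>, so one type that is large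
  enough for \<open>R\<close> is fixed. The pair of \<open>\<phi>\<close> only depends on the subring generated by the image
  of \<open>\<phi>\<close> and the inverses of its invertible elements; the elements of that subring are sums
  of products of such letters, hence are coded by elements of
  \<^typ>\<open>(bool \<times> 'a) list list\<close>. Theorem \<open>hom_pair_in_Hom\<close> below shows that
  morphisms into rings over any other type contribute no further pairs.
\<close>

definition Hom_carrier :: "('a, 'm) ring_scheme \<Rightarrow> ('a set \<times> 'a set) set" where
  "Hom_carrier R =
     {hom_pair R S \<phi> | (S :: (bool \<times> 'a) list list ring) \<phi>. nonzero_ring S \<and> \<phi> \<in> ring_hom R S}"

definition Hom :: "('a, 'm) ring_scheme \<Rightarrow> ('a set \<times> 'a set) gorder" where
  "Hom R = \<lparr>carrier = Hom_carrier R, eq = (=),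
            le = (\<lambda>p q. fst p \<subseteq> fst q \<and> snd p \<subseteq> snd q)\<rparr>"

definition Hom_map ::
  "('a, 'm) ring_scheme \<Rightarrow> ('a \<Rightarrow> 'b) \<Rightarrow> 'b set \<times> 'b set \<Rightarrow> 'a set \<times> 'a set" where
  "Hom_map R f p = ({r \<in> carrier R. f r \<in> fst p}, {r \<in> carrier R. f r \<in> snd p})"


section \<open>Isomorphism and inverse limits of partially ordered sets\<close>

definition poset_isomorphic :: "'a gorder \<Rightarrow> 'b gorder \<Rightarrow> bool" where
  "poset_isomorphic P Q \<longleftrightarrow>
     (\<exists>f. bij_betw f (carrier P) (carrier Q) \<and>
          (\<forall>x \<in> carrier P. \<forall>y \<in> carrier P. x \<sqsubseteq>\<^bsub>P\<^esub> y \<longleftrightarrow> f x \<sqsubseteq>\<^bsub>Q\<^esub> f y))"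

text \<open>For \<open>leq i j\<close>, the connecting map \<open>f i j\<close> goes from \<open>P j\<close> to \<open>P i\<close>.\<close>

definition inverse_limit ::
  "'i set \<Rightarrow> ('i \<Rightarrow> 'i \<Rightarrow> bool) \<Rightarrow> ('i \<Rightarrow> 'p gorder) \<Rightarrow> ('i \<Rightarrow> 'i \<Rightarrow> 'p \<Rightarrow> 'p)
     \<Rightarrow> ('i \<Rightarrow> 'p) gorder" where
  "inverse_limit I leq P f =
     \<lparr>carrier = {x \<in> (\<Pi>\<^sub>E i\<in>I. carrier (P i)).
                   \<forall>i\<in>I. \<forall>j\<in>I. leq i j \<longrightarrow> f i j (x j) = x i},
      eq = (=),
      le = (\<lambda>x y. \<forall>i\<in>I. x i \<sqsubseteq>\<^bsub>P i\<^esub> y i)\<rparr>"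


section \<open>Direct systems of rings and their direct limits\<close>

locale direct_system =
  fixes I :: "'i set"
    and leq :: "'i \<Rightarrow> 'i \<Rightarrow> bool"
    and R :: "'i \<Rightarrow> ('a, 'm) ring_scheme"
    and \<mu> :: "'i \<Rightarrow> 'i \<Rightarrow> 'a \<Rightarrow> 'a"
  assumes nonempty: "I \<noteq> {}"
    and leq_refl: "i \<in> I \<Longrightarrow> leq i i"
    and leq_trans: "\<lbrakk>i \<in> I; j \<in> I; k \<in> I; leq i j; leq j k\<rbrakk> \<Longrightarrow> leq i k"
    and directed: "\<lbrakk>i \<in> I; j \<in> I\<rbrakk> \<Longrightarrow> \<exists>k\<in>I. leq i k \<and> leq j k"
    and nonzero_ring: "i \<in> I \<Longrightarrow> nonzero_ring (R i)"
    and hom: "\<lbrakk>i \<in> I; j \<in> I; leq i j\<rbrakk> \<Longrightarrow> \<mu> i j \<in> ring_hom (R i) (R j)"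
    and hom_id: "\<lbrakk>i \<in> I; x \<in> carrier (R i)\<rbrakk> \<Longrightarrow> \<mu> i i x = x"
    and hom_comp: "\<lbrakk>i \<in> I; j \<in> I; k \<in> I; leq i j; leq j k; x \<in> carrier (R i)\<rbrakk>
           \<Longrightarrow> \<mu> j k (\<mu> i j x) = \<mu> i k x"

text \<open>
  The direct limit is the usual quotient of the disjoint union of the \<open>R i\<close>. Its operations are
  defined as the union of all classes obtained from representatives; these classes all coincide
  (see \<open>direct_limit_add\<close> and \<open>direct_limit_mult\<close>). The theorems \<open>direct_limit_cocone\<close> and
  \<open>direct_limit_universal\<close> give its universal property.
\<close>

definition direct_limit_rel ::
  "'i set \<Rightarrow> ('i \<Rightarrow> 'i \<Rightarrow> bool) \<Rightarrow> ('i \<Rightarrow> ('a, 'm) ring_scheme) \<Rightarrow> ('i \<Rightarrow> 'i \<Rightarrow> 'a \<Rightarrow> 'a)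
     \<Rightarrow> (('i \<times> 'a) \<times> ('i \<times> 'a)) set" where
  "direct_limit_rel I leq R \<mu> =
     {((i, x), (j, y)) | i x j y.
        i \<in> I \<and> j \<in> I \<and> x \<in> carrier (R i) \<and> y \<in> carrier (R j) \<and>
        (\<exists>k\<in>I. leq i k \<and> leq j k \<and> \<mu> i k x = \<mu> j k y)}"

definition direct_limit_map ::
  "'i set \<Rightarrow> ('i \<Rightarrow> 'i \<Rightarrow> bool) \<Rightarrow> ('i \<Rightarrow> ('a, 'm) ring_scheme) \<Rightarrow> ('i \<Rightarrow> 'i \<Rightarrow> 'a \<Rightarrow> 'a)
     \<Rightarrow> 'i \<Rightarrow> 'a \<Rightarrow> ('i \<times> 'a) set" where
  "direct_limit_map I leq R \<mu> i x = direct_limit_rel I leq R \<mu> `` {(i, x)}"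

definition direct_limit ::
  "'i set \<Rightarrow> ('i \<Rightarrow> 'i \<Rightarrow> bool) \<Rightarrow> ('i \<Rightarrow> ('a, 'm) ring_scheme) \<Rightarrow> ('i \<Rightarrow> 'i \<Rightarrow> 'a \<Rightarrow> 'a)
     \<Rightarrow> ('i \<times> 'a) set ring" where
  "direct_limit I leq R \<mu> =
     \<lparr>carrier = (SIGMA i:I. carrier (R i)) // direct_limit_rel I leq R \<mu>,
      monoid.mult = (\<lambda>A B. \<Union>{direct_limit_map I leq R \<mu> k (\<mu> i k x \<otimes>\<^bsub>R k\<^esub> \<mu> j k y) | i x j y k.
                (i, x) \<in> A \<and> (j, y) \<in> B \<and> k \<in> I \<and> leq i k \<and> leq j k}),
      one = \<Union>{direct_limit_map I leq R \<mu> i \<one>\<^bsub>R i\<^esub> | i. i \<in> I},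
      ring.zero = \<Union>{direct_limit_map I leq R \<mu> i \<zero>\<^bsub>R i\<^esub> | i. i \<in> I},
      add = (\<lambda>A B. \<Union>{direct_limit_map I leq R \<mu> k (\<mu> i k x \<oplus>\<^bsub>R k\<^esub> \<mu> j k y) | i x j y k.
                (i, x) \<in> A \<and> (j, y) \<in> B \<and> k \<in> I \<and> leq i k \<and> leq j k})\<rparr>"


section \<open>The type bound in \<open>Hom_carrier\<close> is harmless\<close>

theorem hom_pair_in_Hom:
  fixes R :: "('a, 'm) ring_scheme" and S :: "('c, 'n) ring_scheme"
  assumes R: "nonzero_ring R" and S: "nonzero_ring S" and \<phi>: "\<phi> \<in> ring_hom R S"
  shows "hom_pair R S \<phi> \<in> carrier (Hom R)"
proof -
  interpret R: nonzero_ring R by (rule R)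
  interpret S: nonzero_ring S by (rule S)
  interpret h: ring_hom_ring R S \<phi>
    by (rule ring_hom_ringI2[OF R.ring_axioms S.ring_axioms \<phi>])
  define letter :: "bool \<times> 'a \<Rightarrow> 'c" where "letter = (\<lambda>(b, r).
    if r \<in> carrier R then (if b then \<phi> r else if \<phi> r \<in> Units S then inv\<^bsub>S\<^esub> (\<phi> r) else \<one>\<^bsub>S\<^esub>) else \<one>\<^bsub>S\<^esub>)"
  define word where "word = (\<lambda>w. foldr (\<otimes>\<^bsub>S\<^esub>) (map letter w) \<one>\<^bsub>S\<^esub>)"
  define ev where "ev = (\<lambda>ws. foldr (\<oplus>\<^bsub>S\<^esub>) (map word ws) \<zero>\<^bsub>S\<^esub>)"
  define T where "T = range ev"
  have letter_in [simp]: "letter p \<in> carrier S" for p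
    by (auto simp: letter_def split: prod.splits)
  have word_in [simp]: "word w \<in> carrier S" for w
    unfolding word_def by (induction w) auto
  have ev_in [simp]: "ev ws \<in> carrier S" for ws
    unfolding ev_def by (induction ws) auto
  have word_append: "word (v @ w) = word v \<otimes>\<^bsub>S\<^esub> word w" for v w
  proof (induction v)
    case Nil
    have "word [] = \<one>\<^bsub>S\<^esub>" by (simp add: word_def)
    then show ?case by simp
  next
    case (Cons p v)
    have c: "word (p # u) = letter p \<otimes>\<^bsub>S\<^esub> word u" for u by (simp add: word_def)
    show ?case by (simp add: c Cons S.m_assoc)
  qed
  have ev_Nil: "ev [] = \<zero>\<^bsub>S\<^esub>" by (simp add: ev_def)
  have ev_Cons: "ev (w # ws) = word w \<oplus>\<^bsub>S\<^esub> ev ws" for w ws by (simp add: ev_def)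
  have ev_append: "ev (v @ w) = ev v \<oplus>\<^bsub>S\<^esub> ev w" for v w
    by (induction v) (simp_all add: ev_Nil ev_Cons S.a_assoc)
  have ev_map: "ev (map ((@) v) ws) = word v \<otimes>\<^bsub>S\<^esub> ev ws" for v ws
    by (induction ws) (simp_all add: ev_Nil ev_Cons word_append S.r_distr)
  have word_single: "word [p] = letter p" for p by (simp add: word_def)
  have ev_single: "ev [[p]] = letter p" for p by (simp add: ev_Cons ev_Nil word_single)
  have ev_mult: "ev (concat (map (\<lambda>v. map ((@) v) ws) vs)) = ev vs \<otimes>\<^bsub>S\<^esub> ev ws" for vs ws
    by (induction vs) (simp_all add: ev_Nil ev_Cons ev_append ev_map S.l_distr)
  have phi_T: "\<phi> r \<in> T" if "r \<in> carrier R" for r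
  proof -
    have "letter (True, r) = \<phi> r" using that by (simp add: letter_def)
    then show ?thesis unfolding T_def using ev_single[of "(True, r)"] by (metis rangeI)
  qed
  have inv_T: "inv\<^bsub>S\<^esub> (\<phi> r) \<in> T" if "r \<in> carrier R" "\<phi> r \<in> Units S" for r
  proof -
    have "letter (False, r) = inv\<^bsub>S\<^esub> (\<phi> r)" using that by (simp add: letter_def)
    then show ?thesis unfolding T_def using ev_single[of "(False, r)"] by (metis rangeI)
  qed
  have mult_T: "x \<otimes>\<^bsub>S\<^esub> y \<in> T" if xy: "x \<in> T" "y \<in> T" for x y
  proof -
    obtain v w where v: "x = ev v" and w: "y = ev w" using xy unfolding T_def by blast
    have "x \<otimes>\<^bsub>S\<^esub> y = ev (concat (map (\<lambda>v. map ((@) v) w) v))" by (simp only: v w ev_mult)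
    then show ?thesis by (simp add: T_def)
  qed
  have add_T: "x \<oplus>\<^bsub>S\<^esub> y \<in> T" if xy: "x \<in> T" "y \<in> T" for x y
  proof -
    obtain v w where v: "x = ev v" and w: "y = ev w" using xy unfolding T_def by blast
    have "x \<oplus>\<^bsub>S\<^esub> y = ev (v @ w)" by (simp only: v w ev_append)
    then show ?thesis by (simp add: T_def)
  qed
  have T_sub: "T \<subseteq> carrier S" by (auto simp: T_def)
  have one_T: "\<one>\<^bsub>S\<^esub> \<in> T" using phi_T[OF R.one_closed] by simp
  have minus_one_T: "\<ominus>\<^bsub>S\<^esub> \<one>\<^bsub>S\<^esub> \<in> T" using phi_T[of "\<ominus>\<^bsub>R\<^esub> \<one>\<^bsub>R\<^esub>"] by simp
  have subT: "subring T S"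
  proof (rule S.subringI[OF T_sub one_T _ mult_T add_T])
    fix x assume x: "x \<in> T"
    then have "\<ominus>\<^bsub>S\<^esub> x = (\<ominus>\<^bsub>S\<^esub> \<one>\<^bsub>S\<^esub>) \<otimes>\<^bsub>S\<^esub> x" using T_sub by (auto simp: S.l_minus)
    then show "\<ominus>\<^bsub>S\<^esub> x \<in> T" using mult_T[OF minus_one_T x] by simp
  qed
  define S1 where "S1 = S\<lparr>carrier := T\<rparr>"
  have S1: "ring S1" unfolding S1_def by (rule S.subring_is_ring[OF subT])
  have S1_simps: "carrier S1 = T" "monoid.mult S1 = monoid.mult S" "add S1 = add S" "one S1 = one S"
    "\<zero>\<^bsub>S1\<^esub> = \<zero>\<^bsub>S\<^esub>"
    by (simp_all add: S1_def)
  define g where "g = inv_into UNIV ev"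
  have ev_g: "ev (g x) = x" if "x \<in> T" for x
    using that unfolding g_def T_def by (rule f_inv_into_f)
  have g_inj: "inj_on g (carrier S1)"
    by (rule inj_on_inverseI[of _ ev]) (simp add: S1_simps ev_g)
  define S2 where "S2 = image_ring g S1"
  have S2: "ring S2" unfolding S2_def by (rule ring.inj_imp_image_ring_is_ring[OF S1 g_inj])
  have g_hom: "g \<in> ring_iso S1 S2" unfolding S2_def by (rule inj_imp_image_ring_iso[OF g_inj])
  interpret S1: ring S1 by (rule S1)
  interpret S2: ring S2 by (rule S2)
  interpret g: ring_hom_ring S1 S2 g
    using g_hom by (intro ring_hom_ringI2) (auto simp: ring_iso_def S1 S2)
  have g_bij: "bij_betw g (carrier S1) (carrier S2)" using g_hom by (simp add: ring_iso_def)
  have nz: "nonzero_ring S2"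
  proof (intro nonzero_ring.intro nonzero_ring_axioms.intro S2)
    show "\<one>\<^bsub>S2\<^esub> \<noteq> \<zero>\<^bsub>S2\<^esub>"
    proof
      assume "\<one>\<^bsub>S2\<^esub> = \<zero>\<^bsub>S2\<^esub>"
      then have "g \<one>\<^bsub>S1\<^esub> = g \<zero>\<^bsub>S1\<^esub>" by simp
      then have "\<one>\<^bsub>S1\<^esub> = \<zero>\<^bsub>S1\<^esub>"
        using inj_onD[OF g_inj] S1.one_closed S1.zero_closed by blast
      then show False using S.one_not_zero by (simp add: S1_simps)
    qed
  qed
  have phi1: "\<phi> \<in> ring_hom R S1"
    using \<phi> phi_T by (auto simp: ring_hom_def S1_simps)
  have comp: "g \<circ> \<phi> \<in> ring_hom R S2"
    by (rule ring_hom_trans[OF phi1 g.homh])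
  have ker: "a_kernel R S2 (g \<circ> \<phi>) = a_kernel R S \<phi>"
  proof -
    have "g (\<phi> r) = \<zero>\<^bsub>S2\<^esub> \<longleftrightarrow> \<phi> r = \<zero>\<^bsub>S\<^esub>" if "r \<in> carrier R" for r
      using inj_onD[OF g_inj, of "\<phi> r" "\<zero>\<^bsub>S1\<^esub>"] phi_T[OF that] g.hom_zero S1.zero_closed
      unfolding S1_simps by metis
    then show ?thesis unfolding a_kernel_def' comp_apply by blast
  qed
  have un: "g (\<phi> r) \<in> Units S2 \<longleftrightarrow> \<phi> r \<in> Units S" if r: "r \<in> carrier R" for r
  proof
    assume u: "\<phi> r \<in> Units S"
    define y where "y = inv\<^bsub>S\<^esub> (\<phi> r)"
    have y: "y \<in> carrier S1" "y \<otimes>\<^bsub>S1\<^esub> \<phi> r = \<one>\<^bsub>S1\<^esub>" "\<phi> r \<otimes>\<^bsub>S1\<^esub> y = \<one>\<^bsub>S1\<^esub>"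
      unfolding S1_simps y_def
      by (rule inv_T[OF r u], rule S.Units_l_inv[OF u], rule S.Units_r_inv[OF u])
    have p: "\<phi> r \<in> carrier S1" using phi_T[OF r] by (simp add: S1_simps)
    have "g y \<otimes>\<^bsub>S2\<^esub> g (\<phi> r) = \<one>\<^bsub>S2\<^esub>" "g (\<phi> r) \<otimes>\<^bsub>S2\<^esub> g y = \<one>\<^bsub>S2\<^esub>"
      using y p by (metis g.hom_mult g.hom_one)+
    then show "g (\<phi> r) \<in> Units S2"
      unfolding Units_def using g.hom_closed[OF p] g.hom_closed[OF y(1)] by auto
  next
    assume "g (\<phi> r) \<in> Units S2"
    then obtain z where z: "z \<in> carrier S2" "z \<otimes>\<^bsub>S2\<^esub> g (\<phi> r) = \<one>\<^bsub>S2\<^esub>" "g (\<phi> r) \<otimes>\<^bsub>S2\<^esub> z = \<one>\<^bsub>S2\<^esub>"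
      by (auto simp: Units_def)
    obtain y where y: "y \<in> carrier S1" "z = g y"
      using z(1) g_bij by (auto simp: bij_betw_def)
    have p: "\<phi> r \<in> carrier S1" using phi_T[OF r] by (simp add: S1_simps)
    have "g (y \<otimes>\<^bsub>S1\<^esub> \<phi> r) = g \<one>\<^bsub>S1\<^esub>" "g (\<phi> r \<otimes>\<^bsub>S1\<^esub> y) = g \<one>\<^bsub>S1\<^esub>"
      using z y p by (metis g.hom_mult g.hom_one)+
    then have "y \<otimes>\<^bsub>S1\<^esub> \<phi> r = \<one>\<^bsub>S1\<^esub>" "\<phi> r \<otimes>\<^bsub>S1\<^esub> y = \<one>\<^bsub>S1\<^esub>"
      using inj_onD[OF g_inj] y(1) p by (meson S1.m_closed S1.one_closed)+
    then show "\<phi> r \<in> Units S"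
      unfolding Units_def using y(1) T_sub r by (auto simp: S1_simps)
  qed
  have "hom_pair R S2 (g \<circ> \<phi>) = hom_pair R S \<phi>"
    unfolding hom_pair_def ker comp_apply using un by blast
  then show ?thesis
    unfolding Hom_def Hom_carrier_def using nz comp by force
qed

theorem Hom_partial_order: "partial_order (Hom R)"
  by unfold_locales (auto simp: Hom_def prod_eq_iff)

theorem Hom_map_closed:
  assumes R: "nonzero_ring R" and f: "f \<in> ring_hom R R'" and p: "p \<in> carrier (Hom R')"
  shows "Hom_map R f p \<in> carrier (Hom R)"
proof -
  obtain S :: "(bool \<times> 'c) list list ring" and \<phi> where
    S: "nonzero_ring S" "\<phi> \<in> ring_hom R' S" "p = hom_pair R' S \<phi>"
    using p by (auto simp: Hom_def Hom_carrier_def)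
  have "Hom_map R f p = hom_pair R S (\<phi> \<circ> f)"
    unfolding S(3) Hom_map_def hom_pair_def a_kernel_def' fst_conv snd_conv comp_apply
    using ring_hom_closed[OF f] by blast
  then show ?thesis
    using hom_pair_in_Hom[OF R S(1) ring_hom_trans[OF f S(2)]] by simp
qed


section \<open>Universal property of the direct limit\<close>

context direct_system
begin

abbreviation "L \<equiv> direct_limit I leq R \<mu>"
abbreviation "cls \<equiv> direct_limit_map I leq R \<mu>"

lemma mu_closed: "\<lbrakk>i \<in> I; j \<in> I; leq i j; x \<in> carrier (R i)\<rbrakk> \<Longrightarrow> \<mu> i j x \<in> carrier (R j)"
  by (rule ring_hom_closed[OF hom])

lemma ring: "i \<in> I \<Longrightarrow> ring (R i)"
  by (rule nonzero_ring.axioms(1)[OF nonzero_ring])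

lemma relI:
  assumes "i \<in> I" "j \<in> I" "x \<in> carrier (R i)" "y \<in> carrier (R j)"
    and "k \<in> I" "leq i k" "leq j k" "\<mu> i k x = \<mu> j k y"
  shows "((i, x), (j, y)) \<in> direct_limit_rel I leq R \<mu>"
  unfolding direct_limit_rel_def
  by (intro CollectI exI conjI bexI[of _ k]) (rule refl, fact+)

lemma relE:
  assumes "(p, q) \<in> direct_limit_rel I leq R \<mu>"
  obtains i x j y k where "p = (i, x)" "q = (j, y)" "i \<in> I" "j \<in> I" "x \<in> carrier (R i)"
    "y \<in> carrier (R j)" "k \<in> I" "leq i k" "leq j k" "\<mu> i k x = \<mu> j k y"
  using assms unfolding direct_limit_rel_def
  by (elim CollectE exE conjE bexE Pair_inject) (rule that)

lemma equiv_rel: "equiv (SIGMA i:I. carrier (R i)) (direct_limit_rel I leq R \<mu>)"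
proof (rule equivI)
  show "direct_limit_rel I leq R \<mu> \<subseteq> (SIGMA i:I. carrier (R i)) \<times> (SIGMA i:I. carrier (R i))"
    unfolding direct_limit_rel_def by blast
  show "refl_on (SIGMA i:I. carrier (R i)) (direct_limit_rel I leq R \<mu>)"
  proof (rule refl_onI)
    fix p assume "p \<in> (SIGMA i:I. carrier (R i))"
    then obtain i x where p: "p = (i, x)" and i: "i \<in> I" "x \<in> carrier (R i)" by blast
    show "(p, p) \<in> direct_limit_rel I leq R \<mu>"
      unfolding p by (rule relI[OF i(1,1) i(2,2) i(1) leq_refl[OF i(1)] leq_refl[OF i(1)] refl])
  qed
  show "sym (direct_limit_rel I leq R \<mu>)"
  proof (rule symI)
    fix p q assume "(p, q) \<in> direct_limit_rel I leq R \<mu>"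
    then show "(q, p) \<in> direct_limit_rel I leq R \<mu>"
      by (rule relE) (simp only:, rule relI, assumption+, rule sym)
  qed
  show "trans (direct_limit_rel I leq R \<mu>)"
  proof (rule transI)
    fix p q r
    assume pq: "(p, q) \<in> direct_limit_rel I leq R \<mu>" and qr: "(q, r) \<in> direct_limit_rel I leq R \<mu>"
    obtain i x j y m where e: "p = (i, x)" "q = (j, y)" "i \<in> I" "j \<in> I" "x \<in> carrier (R i)"
      "y \<in> carrier (R j)" and m: "m \<in> I" "leq i m" "leq j m" "\<mu> i m x = \<mu> j m y"
      using pq by (rule relE)
    obtain j' y' k z n where e': "q = (j', y')" "r = (k, z)" "j' \<in> I" "k \<in> I"
      "y' \<in> carrier (R j')" "z \<in> carrier (R k)"
      and n': "n \<in> I" "leq j' n" "leq k n" "\<mu> j' n y' = \<mu> k n z"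
      using qr by (rule relE)
    have "j' = j" "y' = y" using e(2) e'(1) by simp_all
    note n = n'[unfolded this]
    obtain l where l: "l \<in> I" "leq m l" "leq n l" using directed[OF m(1) n(1)] by blast
    have "\<mu> i l x = \<mu> m l (\<mu> i m x)" by (rule hom_comp[symmetric]) (fact e m l)+
    also have "\<dots> = \<mu> j l y" unfolding m(4) by (rule hom_comp) (fact e m l)+
    also have "\<dots> = \<mu> n l (\<mu> j n y)" by (rule hom_comp[symmetric]) (fact e n l)+
    also have "\<dots> = \<mu> k l z" unfolding n(4) by (rule hom_comp) (fact e' n l)+
    finally have eq: "\<mu> i l x = \<mu> k l z" .
    have "leq i l" by (rule leq_trans[OF e(3) m(1) l(1) m(2) l(2)])
    moreover have "leq k l" by (rule leq_trans[OF e'(4) n(1) l(1) n(3) l(3)])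
    ultimately show "(p, r) \<in> direct_limit_rel I leq R \<mu>"
      unfolding e(1) e'(2) using eq by (intro relI[OF e(3) e'(4) e(5) e'(6) l(1)])
  qed
qed

lemma cls_eq_iff:
  assumes "i \<in> I" "j \<in> I" "x \<in> carrier (R i)" "y \<in> carrier (R j)"
  shows "cls i x = cls j y \<longleftrightarrow> (\<exists>k\<in>I. leq i k \<and> leq j k \<and> \<mu> i k x = \<mu> j k y)"
proof -
  have "cls i x = cls j y \<longleftrightarrow> ((i, x), (j, y)) \<in> direct_limit_rel I leq R \<mu>"
    unfolding direct_limit_map_def
    by (rule eq_equiv_class_iff[OF equiv_rel]) (simp_all add: assms)
  then show ?thesis unfolding direct_limit_rel_def using assms by blast
qed

lemma mem_cls_iff:
  assumes "i \<in> I" "x \<in> carrier (R i)"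
  shows "(j, y) \<in> cls i x \<longleftrightarrow> j \<in> I \<and> y \<in> carrier (R j) \<and> cls j y = cls i x"
proof
  assume "(j, y) \<in> cls i x"
  then have r: "((i, x), (j, y)) \<in> direct_limit_rel I leq R \<mu>" by (simp add: direct_limit_map_def)
  then have "j \<in> I" "y \<in> carrier (R j)" unfolding direct_limit_rel_def by blast+
  moreover have "cls i x = cls j y"
    unfolding direct_limit_map_def by (rule equiv_class_eq[OF equiv_rel r])
  ultimately show "j \<in> I \<and> y \<in> carrier (R j) \<and> cls j y = cls i x" by simp
next
  assume "j \<in> I \<and> y \<in> carrier (R j) \<and> cls j y = cls i x"
  then have "(j, y) \<in> cls j y" "cls j y = cls i x"
    using equiv_class_self[OF equiv_rel, of "(j, y)"] unfolding direct_limit_map_def by simp_all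
  then show "(j, y) \<in> cls i x" by simp
qed

lemma cls_mu:
  assumes "i \<in> I" "j \<in> I" "leq i j" "x \<in> carrier (R i)"
  shows "cls j (\<mu> i j x) = cls i x"
proof -
  have c: "\<mu> i j x \<in> carrier (R j)" using assms by (rule mu_closed)
  have "\<mu> j j (\<mu> i j x) = \<mu> i j x" by (rule hom_id[OF assms(2) c])
  then show ?thesis
    using cls_eq_iff[OF assms(2,1) c assms(4)] assms(2,3) leq_refl[OF assms(2)] by blast
qed

lemma carrier_L: "carrier L = {cls i x | i x. i \<in> I \<and> x \<in> carrier (R i)}"
  unfolding direct_limit_def quotient_def direct_limit_map_def partial_object.simps by blast

lemma cls_closed: "\<lbrakk>i \<in> I; x \<in> carrier (R i)\<rbrakk> \<Longrightarrow> cls i x \<in> carrier L"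
  unfolding carrier_L by blast

lemma common:
  assumes A: "A \<in> carrier L" and B: "B \<in> carrier L" and C: "C \<in> carrier L"
  obtains k x y z where "k \<in> I" "x \<in> carrier (R k)" "y \<in> carrier (R k)" "z \<in> carrier (R k)"
    "A = cls k x" "B = cls k y" "C = cls k z"
proof -
  obtain i x where i: "i \<in> I" "x \<in> carrier (R i)" "A = cls i x"
    using A unfolding carrier_L by blast
  obtain j y where j: "j \<in> I" "y \<in> carrier (R j)" "B = cls j y"
    using B unfolding carrier_L by blast
  obtain l z where l: "l \<in> I" "z \<in> carrier (R l)" "C = cls l z"
    using C unfolding carrier_L by blast
  obtain m where m: "m \<in> I" "leq i m" "leq j m" using directed i j by blast
  obtain n where n: "n \<in> I" "leq m n" "leq l n" using directed l m by blast
  have le: "leq i n" "leq j n" using leq_trans i j m n by blast+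
  show thesis
  proof (rule that[OF n(1)])
    show "\<mu> i n x \<in> carrier (R n)" "\<mu> j n y \<in> carrier (R n)" "\<mu> l n z \<in> carrier (R n)"
      using i j l n le mu_closed by blast+
    show "A = cls n (\<mu> i n x)" "B = cls n (\<mu> j n y)" "C = cls n (\<mu> l n z)"
      using cls_mu[OF i(1) n(1) le(1) i(2)] cls_mu[OF j(1) n(1) le(2) j(2)]
        cls_mu[OF l(1) n(1,3) l(2)] i(3) j(3) l(3) by simp_all
  qed
qed

lemma common2:
  assumes "A \<in> carrier L" "B \<in> carrier L"
  obtains k x y where "k \<in> I" "x \<in> carrier (R k)" "y \<in> carrier (R k)" "A = cls k x" "B = cls k y"
  by (rule common[OF assms assms(2)]) (rule that)

lemma operation_eq:
  assumes k: "k \<in> I" "x \<in> carrier (R k)" "y \<in> carrier (R k)"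
    and clo: "\<And>i a b. \<lbrakk>i \<in> I; a \<in> carrier (R i); b \<in> carrier (R i)\<rbrakk> \<Longrightarrow> f i a b \<in> carrier (R i)"
    and hm: "\<And>i j a b. \<lbrakk>i \<in> I; j \<in> I; leq i j; a \<in> carrier (R i); b \<in> carrier (R i)\<rbrakk>
               \<Longrightarrow> \<mu> i j (f i a b) = f j (\<mu> i j a) (\<mu> i j b)"
  shows "\<Union>{cls n (f n (\<mu> i n a) (\<mu> j n b)) | i a j b n.
           (i, a) \<in> cls k x \<and> (j, b) \<in> cls k y \<and> n \<in> I \<and> leq i n \<and> leq j n} = cls k (f k x y)"
proof -
  have main: "cls n (f n (\<mu> i n a) (\<mu> j n b)) = cls k (f k x y)"
    if h: "(i, a) \<in> cls k x" "(j, b) \<in> cls k y" "n \<in> I" "leq i n" "leq j n" for i a j b n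
  proof -
    have i: "i \<in> I" "a \<in> carrier (R i)" "cls i a = cls k x"
      and j: "j \<in> I" "b \<in> carrier (R j)" "cls j b = cls k y"
      using h(1,2) mem_cls_iff[OF k(1,2)] mem_cls_iff[OF k(1,3)] by simp_all
    have an: "\<mu> i n a \<in> carrier (R n)" "\<mu> j n b \<in> carrier (R n)"
      using mu_closed[OF i(1) h(3,4) i(2)] mu_closed[OF j(1) h(3,5) j(2)] .
    have ca: "cls n (\<mu> i n a) = cls k x" "cls n (\<mu> j n b) = cls k y"
      using cls_mu[OF i(1) h(3,4) i(2)] cls_mu[OF j(1) h(3,5) j(2)] i(3) j(3) by simp_all
    obtain p where p: "p \<in> I" "leq n p" "leq k p" "\<mu> n p (\<mu> i n a) = \<mu> k p x"
      using ca(1) cls_eq_iff[OF h(3) k(1) an(1) k(2)] by blast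
    obtain q where q: "q \<in> I" "leq n q" "leq k q" "\<mu> n q (\<mu> j n b) = \<mu> k q y"
      using ca(2) cls_eq_iff[OF h(3) k(1) an(2) k(3)] by blast
    obtain r where r: "r \<in> I" "leq p r" "leq q r" using directed p q by blast
    have nr: "leq n r" "leq k r" using leq_trans p r h k by blast+
    have "\<mu> n r (\<mu> i n a) = \<mu> p r (\<mu> n p (\<mu> i n a))" by (rule hom_comp[symmetric]) (fact h p r an)+
    also have "\<dots> = \<mu> k r x" unfolding p(4) by (rule hom_comp) (fact k p r)+
    finally have 1: "\<mu> n r (\<mu> i n a) = \<mu> k r x" .
    have "\<mu> n r (\<mu> j n b) = \<mu> q r (\<mu> n q (\<mu> j n b))" by (rule hom_comp[symmetric]) (fact h q r an)+
    also have "\<dots> = \<mu> k r y" unfolding q(4) by (rule hom_comp) (fact k q r)+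
    finally have 2: "\<mu> n r (\<mu> j n b) = \<mu> k r y" .
    have "\<mu> n r (f n (\<mu> i n a) (\<mu> j n b)) = \<mu> k r (f k x y)"
      using hm[OF h(3) r(1) nr(1) an] hm[OF k(1) r(1) nr(2) k(2,3)] 1 2 by simp
    then show ?thesis
      using cls_eq_iff[OF h(3) k(1) clo[OF h(3) an] clo[OF k]] r(1) nr by blast
  qed
  have "(k, x) \<in> cls k x" "(k, y) \<in> cls k y" "leq k k" using k leq_refl mem_cls_iff by blast+
  then have ne: "\<exists>i a j b n. (i, a) \<in> cls k x \<and> (j, b) \<in> cls k y \<and> n \<in> I \<and> leq i n \<and> leq j n"
    using k(1) by blast
  have "{cls n (f n (\<mu> i n a) (\<mu> j n b)) | i a j b n.
           (i, a) \<in> cls k x \<and> (j, b) \<in> cls k y \<and> n \<in> I \<and> leq i n \<and> leq j n} = {cls k (f k x y)}"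
    (is "?X = _")
  proof
    show sub: "?X \<subseteq> {cls k (f k x y)}" using main by blast
    obtain i a j b n where "(i, a) \<in> cls k x" "(j, b) \<in> cls k y" "n \<in> I" "leq i n" "leq j n"
      using ne by blast
    then have "cls n (f n (\<mu> i n a) (\<mu> j n b)) \<in> ?X" by blast
    with sub show "{cls k (f k x y)} \<subseteq> ?X" by blast
  qed
  then show ?thesis by (simp only: ccpo_Sup_singleton)
qed

lemma direct_limit_add:
  assumes "k \<in> I" "x \<in> carrier (R k)" "y \<in> carrier (R k)"
  shows "cls k x \<oplus>\<^bsub>L\<^esub> cls k y = cls k (x \<oplus>\<^bsub>R k\<^esub> y)"
  unfolding direct_limit_def ring.simps
  by (rule operation_eq[OF assms])
    (erule ring.ring_simprules(1)[OF ring], assumption+, rule ring_hom_add[OF hom], assumption+)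

lemma direct_limit_mult:
  assumes "k \<in> I" "x \<in> carrier (R k)" "y \<in> carrier (R k)"
  shows "cls k x \<otimes>\<^bsub>L\<^esub> cls k y = cls k (x \<otimes>\<^bsub>R k\<^esub> y)"
  unfolding direct_limit_def monoid.simps
  by (rule operation_eq[OF assms])
    (erule ring.ring_simprules(5)[OF ring], assumption+, rule ring_hom_mult[OF hom], assumption+)

lemma const_eq:
  assumes k: "k \<in> I"
    and clo: "\<And>i. i \<in> I \<Longrightarrow> c i \<in> carrier (R i)"
    and hm: "\<And>i j. \<lbrakk>i \<in> I; j \<in> I; leq i j\<rbrakk> \<Longrightarrow> \<mu> i j (c i) = c j"
  shows "\<Union>{cls i (c i) | i. i \<in> I} = cls k (c k)"
proof -
  have "cls i (c i) = cls k (c k)" if i: "i \<in> I" for i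
  proof -
    obtain n where n: "n \<in> I" "leq i n" "leq k n" using directed[OF i k] by blast
    then have "\<mu> i n (c i) = \<mu> k n (c k)" using hm i k by simp
    then show ?thesis using cls_eq_iff[OF i k clo[OF i] clo[OF k]] n by blast
  qed
  then have "{cls i (c i) | i. i \<in> I} = {cls k (c k)}" using k by blast
  then show ?thesis by (simp only: ccpo_Sup_singleton)
qed

lemma direct_limit_one:
  assumes "k \<in> I" shows "\<one>\<^bsub>L\<^esub> = cls k \<one>\<^bsub>R k\<^esub>"
  unfolding direct_limit_def monoid.simps
  by (rule const_eq[OF assms])
    (erule ring.ring_simprules(6)[OF ring], rule ring_hom_one[OF hom], assumption+)

lemma direct_limit_zero:
  assumes "k \<in> I" shows "\<zero>\<^bsub>L\<^esub> = cls k \<zero>\<^bsub>R k\<^esub>"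
  unfolding direct_limit_def ring.simps
  by (rule const_eq[OF assms])
    (erule ring.ring_simprules(2)[OF ring], rule ring_hom_zero[OF hom ring ring], assumption+)

theorem direct_limit_nonzero_ring: "nonzero_ring L"
proof -
  obtain k0 where k0: "k0 \<in> I" using nonempty by blast
  interpret R0: nonzero_ring "R k0" by (rule nonzero_ring[OF k0])
  have zero_cl: "\<zero>\<^bsub>L\<^esub> \<in> carrier L"
    unfolding direct_limit_zero[OF k0] by (rule cls_closed[OF k0 R0.zero_closed])
  have one_cl: "\<one>\<^bsub>L\<^esub> \<in> carrier L"
    unfolding direct_limit_one[OF k0] by (rule cls_closed[OF k0 R0.one_closed])
  have two: "A \<oplus>\<^bsub>L\<^esub> B \<in> carrier L \<and> A \<otimes>\<^bsub>L\<^esub> B \<in> carrier L \<and> A \<oplus>\<^bsub>L\<^esub> B = B \<oplus>\<^bsub>L\<^esub> A"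
    if AB: "A \<in> carrier L" "B \<in> carrier L" for A B
  proof -
    obtain k x y where k: "k \<in> I" and x: "x \<in> carrier (R k)" and y: "y \<in> carrier (R k)"
      and eq: "A = cls k x" "B = cls k y" by (rule common2[OF AB])
    interpret Rk: ring "R k" by (rule ring[OF k])
    show ?thesis
      unfolding eq direct_limit_add[OF k x y] direct_limit_add[OF k y x] direct_limit_mult[OF k x y]
      using cls_closed[OF k] x y Rk.a_comm[OF x y] by simp
  qed
  have one: "\<zero>\<^bsub>L\<^esub> \<oplus>\<^bsub>L\<^esub> A = A \<and> (\<exists>B\<in>carrier L. B \<oplus>\<^bsub>L\<^esub> A = \<zero>\<^bsub>L\<^esub>) \<and>
      \<one>\<^bsub>L\<^esub> \<otimes>\<^bsub>L\<^esub> A = A \<and> A \<otimes>\<^bsub>L\<^esub> \<one>\<^bsub>L\<^esub> = A" if A: "A \<in> carrier L" for A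
  proof -
    obtain k x where k: "k \<in> I" and x: "x \<in> carrier (R k)" and eq: "A = cls k x"
      by (rule common2[OF A A])
    interpret Rk: ring "R k" by (rule ring[OF k])
    have m: "\<ominus>\<^bsub>R k\<^esub> x \<in> carrier (R k)" using x by simp
    have "cls k (\<ominus>\<^bsub>R k\<^esub> x) \<oplus>\<^bsub>L\<^esub> A = \<zero>\<^bsub>L\<^esub>"
      unfolding eq direct_limit_zero[OF k] direct_limit_add[OF k m x] using x by (simp add: Rk.l_neg)
    then show ?thesis
      unfolding eq direct_limit_zero[OF k] direct_limit_one[OF k]
        direct_limit_add[OF k Rk.zero_closed x] direct_limit_mult[OF k Rk.one_closed x]
        direct_limit_mult[OF k x Rk.one_closed]
      using x cls_closed[OF k m] by auto
  qed
  have three: "A \<oplus>\<^bsub>L\<^esub> B \<oplus>\<^bsub>L\<^esub> C = A \<oplus>\<^bsub>L\<^esub> (B \<oplus>\<^bsub>L\<^esub> C) \<and>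
      A \<otimes>\<^bsub>L\<^esub> B \<otimes>\<^bsub>L\<^esub> C = A \<otimes>\<^bsub>L\<^esub> (B \<otimes>\<^bsub>L\<^esub> C) \<and>
      (A \<oplus>\<^bsub>L\<^esub> B) \<otimes>\<^bsub>L\<^esub> C = A \<otimes>\<^bsub>L\<^esub> C \<oplus>\<^bsub>L\<^esub> B \<otimes>\<^bsub>L\<^esub> C \<and>
      C \<otimes>\<^bsub>L\<^esub> (A \<oplus>\<^bsub>L\<^esub> B) = C \<otimes>\<^bsub>L\<^esub> A \<oplus>\<^bsub>L\<^esub> C \<otimes>\<^bsub>L\<^esub> B"
    if ABC: "A \<in> carrier L" "B \<in> carrier L" "C \<in> carrier L" for A B C
  proof -
    obtain k x y z where k: "k \<in> I"
      and xyz: "x \<in> carrier (R k)" "y \<in> carrier (R k)" "z \<in> carrier (R k)"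
      and eq: "A = cls k x" "B = cls k y" "C = cls k z" by (rule common[OF ABC])
    interpret Rk: ring "R k" by (rule ring[OF k])
    show ?thesis
      unfolding eq using xyz
      by (simp add: direct_limit_add[OF k] direct_limit_mult[OF k] Rk.a_assoc Rk.m_assoc
          Rk.l_distr Rk.r_distr)
  qed
  have "ring L"
  proof (rule ringI)
    show "abelian_group L"
      by (rule abelian_groupI) (use zero_cl one two three in \<open>simp_all only:\<close>)
    show "monoid L"
      by (rule monoidI) (use one_cl one two three in \<open>simp_all only:\<close>)
  qed (use three in \<open>simp_all only:\<close>)
  moreover have "\<one>\<^bsub>L\<^esub> \<noteq> \<zero>\<^bsub>L\<^esub>"
  proof
    assume "\<one>\<^bsub>L\<^esub> = \<zero>\<^bsub>L\<^esub>"
    then have "cls k0 \<one>\<^bsub>R k0\<^esub> = cls k0 \<zero>\<^bsub>R k0\<^esub>"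
      unfolding direct_limit_one[OF k0] direct_limit_zero[OF k0] .
    then obtain k where k: "k \<in> I" "leq k0 k" "\<mu> k0 k \<one>\<^bsub>R k0\<^esub> = \<mu> k0 k \<zero>\<^bsub>R k0\<^esub>"
      using cls_eq_iff[OF k0 k0 R0.one_closed R0.zero_closed] by blast
    then have "\<one>\<^bsub>R k\<^esub> = \<zero>\<^bsub>R k\<^esub>"
      using ring_hom_one[OF hom[OF k0 k(1,2)]]
        ring_hom_zero[OF hom[OF k0 k(1,2)] ring[OF k0] ring[OF k(1)]] by simp
    then show False using nonzero_ring.one_not_zero[OF nonzero_ring[OF k(1)]] by simp
  qed
  ultimately show ?thesis by (intro nonzero_ring.intro nonzero_ring_axioms.intro)
qed

theorem direct_limit_cocone:
  shows "i \<in> I \<Longrightarrow> cls i \<in> ring_hom (R i) L"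
    and "\<lbrakk>i \<in> I; j \<in> I; leq i j; x \<in> carrier (R i)\<rbrakk> \<Longrightarrow> cls j (\<mu> i j x) = cls i x"
proof -
  assume i: "i \<in> I"
  show "cls i \<in> ring_hom (R i) L"
    by (rule ring_hom_memI) (simp_all only: i cls_closed direct_limit_add direct_limit_mult
        direct_limit_one[OF i])
qed (rule cls_mu)

theorem direct_limit_universal:
  fixes T :: "('t, 'n) ring_scheme"
  assumes T: "ring T" and g: "\<And>i. i \<in> I \<Longrightarrow> g i \<in> ring_hom (R i) T"
    and comp: "\<And>i j x. \<lbrakk>i \<in> I; j \<in> I; leq i j; x \<in> carrier (R i)\<rbrakk> \<Longrightarrow> g j (\<mu> i j x) = g i x"
  shows "\<exists>!h. h \<in> ring_hom L T \<and> h \<in> extensional (carrier L) \<and>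
              (\<forall>i\<in>I. \<forall>x\<in>carrier (R i). h (cls i x) = g i x)"
proof -
  define h where "h = (\<lambda>A. if A \<in> carrier L
      then (let p = SOME p. fst p \<in> I \<and> snd p \<in> carrier (R (fst p)) \<and> A = cls (fst p) (snd p)
            in g (fst p) (snd p)) else undefined)"
  have h: "h (cls i x) = g i x" if ix: "i \<in> I" "x \<in> carrier (R i)" for i x
  proof -
    let ?P = "\<lambda>p. fst p \<in> I \<and> snd p \<in> carrier (R (fst p)) \<and> cls i x = cls (fst p) (snd p)"
    define p where "p = (SOME p. ?P p)"
    have "?P p" unfolding p_def by (rule someI[of ?P "(i, x)"]) (use ix in simp)
    then have P: "fst p \<in> I" "snd p \<in> carrier (R (fst p))" "cls i x = cls (fst p) (snd p)"
      by blast+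
    then obtain k where k: "k \<in> I" "leq i k" "leq (fst p) k" "\<mu> i k x = \<mu> (fst p) k (snd p)"
      using cls_eq_iff[OF ix(1) P(1) ix(2) P(2)] by blast
    have "g i x = g (fst p) (snd p)"
      using comp[OF ix(1) k(1,2) ix(2)] comp[OF P(1) k(1,3) P(2)] k(4) by simp
    then show ?thesis
      unfolding h_def Let_def p_def[symmetric] using cls_closed[OF ix] by simp
  qed
  obtain k0 where k0: "k0 \<in> I" using nonempty by blast
  have hh: "h \<in> ring_hom L T"
  proof (rule ring_hom_memI)
    fix A assume A: "A \<in> carrier L"
    obtain k x where k: "k \<in> I" and x: "x \<in> carrier (R k)" and eq: "A = cls k x"
      by (rule common2[OF A A])
    show "h A \<in> carrier T" unfolding eq h[OF k x] by (rule ring_hom_closed[OF g[OF k] x])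
    fix B assume B: "B \<in> carrier L"
    obtain k x y where k: "k \<in> I" and x: "x \<in> carrier (R k)" and y: "y \<in> carrier (R k)"
      and eq: "A = cls k x" "B = cls k y" by (rule common2[OF A B])
    interpret Rk: ring "R k" by (rule ring[OF k])
    show "h (A \<otimes>\<^bsub>L\<^esub> B) = h A \<otimes>\<^bsub>T\<^esub> h B"
      unfolding eq direct_limit_mult[OF k x y] h[OF k x] h[OF k y] h[OF k Rk.m_closed[OF x y]]
      by (rule ring_hom_mult[OF g[OF k] x y])
    show "h (A \<oplus>\<^bsub>L\<^esub> B) = h A \<oplus>\<^bsub>T\<^esub> h B"
      unfolding eq direct_limit_add[OF k x y] h[OF k x] h[OF k y] h[OF k Rk.a_closed[OF x y]]
      by (rule ring_hom_add[OF g[OF k] x y])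
  next
    interpret R0: ring "R k0" by (rule ring[OF k0])
    show "h \<one>\<^bsub>L\<^esub> = \<one>\<^bsub>T\<^esub>"
      unfolding direct_limit_one[OF k0] h[OF k0 R0.one_closed] by (rule ring_hom_one[OF g[OF k0]])
  qed
  show ?thesis
  proof (rule ex1I[of _ h])
    show "h \<in> ring_hom L T \<and> h \<in> extensional (carrier L) \<and>
        (\<forall>i\<in>I. \<forall>x\<in>carrier (R i). h (cls i x) = g i x)"
      using hh h unfolding h_def extensional_def by simp
    fix h' assume h': "h' \<in> ring_hom L T \<and> h' \<in> extensional (carrier L) \<and>
        (\<forall>i\<in>I. \<forall>x\<in>carrier (R i). h' (cls i x) = g i x)"
    show "h' = h"
    proof (rule extensionalityI[of h' "carrier L" h])
      show "h' \<in> extensional (carrier L)" using h' by blast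
      show "h \<in> extensional (carrier L)" unfolding h_def extensional_def by simp
      fix A assume A: "A \<in> carrier L"
      obtain k x where k: "k \<in> I" and x: "x \<in> carrier (R k)" and eq: "A = cls k x"
        by (rule common2[OF A A])
      show "h' A = h A" using h[OF k x] h' k x unfolding eq by simp
    qed
  qed
qed

end

end

theory Submission
  imports Defs
begin

text \<open>
  The isomorphism restricts a pair on the direct limit \<open>L\<close> along the canonical morphisms
  \<open>R i \<rightarrow> L\<close>. As the images of these morphisms cover \<open>L\<close>, a pair is determined by its
  restrictions, and inclusions between pairs can be checked on them
  (\<open>Hom_map_cls_le_iff\<close>). So the restriction is an order embedding, and what is left is its
  surjectivity: every compatible family \<open>(\<aa> i, M i)\<close> comes from one ring morphism on \<open>L\<close>.

  Choose for each \<open>j\<close> a morphism \<open>\<phi> j : R j \<rightarrow> S j\<close> with pair \<open>(\<aa> j, M j)\<close>. These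
  choices are unrelated, so the rings \<open>S j\<close> come without connecting maps and do not form a direct
  system. A product needs no such maps: let \<open>T\<close> be the product of all \<open>S j\<close>, where families that agree
  from some index on are identified. An element \<open>r\<close> of \<open>R i\<close> is sent to the class of the family
  \<open>j \<mapsto> \<phi> j (\<mu> i j r)\<close>, which makes sense for all \<open>j\<close> above \<open>i\<close>. Up to eventual equality,
  this is a ring morphism and commutes with the connecting maps, so it extends to \<open>L\<close>.
  In \<open>T\<close> both properties recorded by a pair are decided eventually and componentwise: a class is
  zero (invertible) if and only if the components of a representative are so from some index on
  (\<open>germ_eq_zero_iff\<close>, \<open>germ_in_Units_iff\<close>). By compatibility, \<open>\<mu> i j r\<close> lies in \<open>\<aa> j\<close> (in
  \<open>M j\<close>) for one \<open>j\<close> above \<open>i\<close> if and only if it does for all of them, and if and only if \<open>r\<close>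
  lies in \<open>\<aa> i\<close> (in \<open>M i\<close>). So the morphism on \<open>L\<close> restricts to the given family
  (\<open>compatible_family_realized\<close>).
\<close>

section \<open>Reduced products of rings\<close>

definition product_ring :: "'i set \<Rightarrow> ('i \<Rightarrow> ('b, 'n) ring_scheme) \<Rightarrow> ('i \<Rightarrow> 'b) ring" where
  "product_ring I S =
     \<lparr>carrier = (\<Pi>\<^sub>E i\<in>I. carrier (S i)),
      monoid.mult = (\<lambda>x y. \<lambda>i\<in>I. x i \<otimes>\<^bsub>S i\<^esub> y i),
      one = (\<lambda>i\<in>I. \<one>\<^bsub>S i\<^esub>),
      ring.zero = (\<lambda>i\<in>I. \<zero>\<^bsub>S i\<^esub>),
      add = (\<lambda>x y. \<lambda>i\<in>I. x i \<oplus>\<^bsub>S i\<^esub> y i)\<rparr>"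

lemma product_ring_simps [simp]:
  "carrier (product_ring I S) = (\<Pi>\<^sub>E i\<in>I. carrier (S i))"
  "x \<otimes>\<^bsub>product_ring I S\<^esub> y = (\<lambda>i\<in>I. x i \<otimes>\<^bsub>S i\<^esub> y i)"
  "\<one>\<^bsub>product_ring I S\<^esub> = (\<lambda>i\<in>I. \<one>\<^bsub>S i\<^esub>)"
  "\<zero>\<^bsub>product_ring I S\<^esub> = (\<lambda>i\<in>I. \<zero>\<^bsub>S i\<^esub>)"
  "x \<oplus>\<^bsub>product_ring I S\<^esub> y = (\<lambda>i\<in>I. x i \<oplus>\<^bsub>S i\<^esub> y i)"
  by (simp_all add: product_ring_def)

text \<open>
  The filter axioms are what makes the families that vanish almost everywhere an ideal, so reduced
  products are treated for an arbitrary filter \<open>F\<close> on the index set. The filter lives on the whole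
  index type, and \<open>eventually_index\<close> says that it is concentrated on \<open>I\<close>.
\<close>

locale ring_family =
  fixes I :: "'i set" and S :: "'i \<Rightarrow> ('b, 'n) ring_scheme" and F :: "'i filter"
  assumes ring_component: "i \<in> I \<Longrightarrow> ring (S i)"
    and eventually_index: "eventually (\<lambda>i. i \<in> I) F"
begin

abbreviation "P \<equiv> product_ring I S"

lemma ring_product: "ring P"
proof (rule ringI)
  show "abelian_group P"
  proof (rule abelian_groupI)
    fix x assume x: "x \<in> carrier P"
    show "\<exists>y\<in>carrier P. y \<oplus>\<^bsub>P\<^esub> x = \<zero>\<^bsub>P\<^esub>"
      by (rule bexI[of _ "\<lambda>i\<in>I. \<ominus>\<^bsub>S i\<^esub> x i"])
        (use x in \<open>auto simp: fun_eq_iff PiE_iff ring.ring_simprules[OF ring_component]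
            intro!: ring.ring_simprules[OF ring_component]\<close>)
  qed (auto simp: fun_eq_iff PiE_iff extensional_def ring.ring_simprules(1,2)[OF ring_component]
      ring.ring_simprules(8)[OF ring_component]
      intro: ring.ring_simprules(7,10)[OF ring_component])
  show "monoid P"
    by (rule monoidI)
      (auto simp: fun_eq_iff PiE_iff extensional_def ring.ring_simprules(5,6,11,12)[OF ring_component]
        monoid.r_one[OF ring.is_monoid[OF ring_component]])
qed (auto simp: fun_eq_iff PiE_iff ring.ring_simprules(13)[OF ring_component]
    ring.ring_simprules(23)[OF ring_component])

definition null_families :: "('i \<Rightarrow> 'b) set" where
  "null_families = {x \<in> carrier P. eventually (\<lambda>i. x i = \<zero>\<^bsub>S i\<^esub>) F}"

lemma projection_hom: "i \<in> I \<Longrightarrow> (\<lambda>x. x i) \<in> ring_hom P (S i)"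
  by (rule ring_hom_memI) auto

lemma minus_component:
  assumes "i \<in> I" "x \<in> carrier P"
  shows "(\<ominus>\<^bsub>P\<^esub> x) i = \<ominus>\<^bsub>S i\<^esub> x i"
proof -
  interpret h: ring_hom_ring P "S i" "\<lambda>x. x i"
    by (rule ring_hom_ringI2[OF ring_product ring_component[OF assms(1)] projection_hom[OF assms(1)]])
  show ?thesis by (rule h.hom_a_inv[OF assms(2)])
qed

lemma ideal_null_families: "ideal null_families P"
proof -
  interpret P: ring P by (rule ring_product)
  note simprules = ring.ring_simprules[OF ring_component]
  have mult_null: "x \<otimes>\<^bsub>P\<^esub> y \<in> null_families \<and> y \<otimes>\<^bsub>P\<^esub> x \<in> null_families"
    if x: "x \<in> null_families" and y: "y \<in> carrier P" for x y
  proof -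
    have "eventually (\<lambda>i. i \<in> I \<and> x i = \<zero>\<^bsub>S i\<^esub>) F"
      using x eventually_index by (auto simp: null_families_def intro: eventually_conj)
    then have "eventually (\<lambda>i. (x \<otimes>\<^bsub>P\<^esub> y) i = \<zero>\<^bsub>S i\<^esub> \<and> (y \<otimes>\<^bsub>P\<^esub> x) i = \<zero>\<^bsub>S i\<^esub>) F"
      by (rule eventually_mono)
        (use y in \<open>auto simp: PiE_iff simprules\<close>)
    then show ?thesis
      using x y P.m_closed[of x y] P.m_closed[of y x]
      unfolding null_families_def by (auto elim: eventually_mono)
  qed
  show ?thesis
  proof (rule idealI[OF ring_product])
    show "subgroup null_families (add_monoid P)"
    proof (rule P.add.subgroupI)
      show "null_families \<subseteq> carrier P" unfolding null_families_def by blast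
      have "\<zero>\<^bsub>P\<^esub> \<in> null_families"
        using P.zero_closed eventually_mono[OF eventually_index]
        by (auto simp: null_families_def)
      then show "null_families \<noteq> {}" by blast
    next
      fix x assume x: "x \<in> null_families"
      then have "eventually (\<lambda>i. i \<in> I \<and> x i = \<zero>\<^bsub>S i\<^esub>) F" and xP: "x \<in> carrier P"
        using eventually_index by (auto simp: null_families_def intro: eventually_conj)
      then have "eventually (\<lambda>i. (\<ominus>\<^bsub>P\<^esub> x) i = \<zero>\<^bsub>S i\<^esub>) F"
        by (elim eventually_mono) (metis minus_component ring.minus_zero ring_component)
      then show "\<ominus>\<^bsub>P\<^esub> x \<in> null_families"
        using P.a_inv_closed[OF xP] by (simp add: null_families_def)
    next
      fix x y assume xy: "x \<in> null_families" "y \<in> null_families"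
      have "eventually (\<lambda>i. i \<in> I \<and> x i = \<zero>\<^bsub>S i\<^esub> \<and> y i = \<zero>\<^bsub>S i\<^esub>) F"
        using xy eventually_index by (auto simp: null_families_def intro: eventually_conj)
      then have "eventually (\<lambda>i. (x \<oplus>\<^bsub>P\<^esub> y) i = \<zero>\<^bsub>S i\<^esub>) F"
        by (rule eventually_mono) (auto simp: simprules)
      then show "x \<oplus>\<^bsub>P\<^esub> y \<in> null_families"
        using P.a_closed[of x y] xy unfolding null_families_def by blast
    qed
  qed (use mult_null in blast)+
qed

definition germ :: "('i \<Rightarrow> 'b) \<Rightarrow> ('i \<Rightarrow> 'b) set" where
  "germ x = null_families +>\<^bsub>P\<^esub> x"

abbreviation "reduced_product \<equiv> P Quot null_families"

lemma ring_reduced_product: "ring reduced_product"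
  by (rule ideal.quotient_is_ring[OF ideal_null_families])

lemma germ_hom: "germ \<in> ring_hom P reduced_product"
  using ideal.rcos_ring_hom[OF ideal_null_families] by (simp add: germ_def[abs_def])

lemma germ_surj:
  assumes "A \<in> carrier reduced_product"
  obtains x where "x \<in> carrier P" "A = germ x"
  using assms unfolding FactRing_simps germ_def by auto

lemma germ_eq_iff:
  assumes x: "x \<in> carrier P" and y: "y \<in> carrier P"
  shows "germ x = germ y \<longleftrightarrow> eventually (\<lambda>i. x i = y i) F"
proof -
  interpret P: ring P by (rule ring_product)
  have diff: "(x \<ominus>\<^bsub>P\<^esub> y) i = \<zero>\<^bsub>S i\<^esub> \<longleftrightarrow> x i = y i" if i: "i \<in> I" for i
  proof -
    interpret Si: ring "S i" by (rule ring_component[OF i])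
    have "x i \<in> carrier (S i)" "y i \<in> carrier (S i)" using x y i by auto
    moreover have "(x \<ominus>\<^bsub>P\<^esub> y) i = x i \<ominus>\<^bsub>S i\<^esub> y i"
      using i minus_component[OF i y] by (simp add: a_minus_def)
    ultimately show ?thesis by simp
  qed
  have "germ x = germ y \<longleftrightarrow> x \<ominus>\<^bsub>P\<^esub> y \<in> null_families"
    unfolding germ_def by (rule P.quotient_eq_iff_same_a_r_cos[OF ideal_null_families x y, symmetric])
  also have "\<dots> \<longleftrightarrow> eventually (\<lambda>i. (x \<ominus>\<^bsub>P\<^esub> y) i = \<zero>\<^bsub>S i\<^esub>) F"
    unfolding null_families_def using P.minus_closed[OF x y] by blast
  also have "\<dots> \<longleftrightarrow> eventually (\<lambda>i. x i = y i) F"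
    by (rule eventually_cong[OF eventually_index diff])
  finally show ?thesis .
qed

lemma reduced_product_zero: "\<zero>\<^bsub>reduced_product\<^esub> = germ \<zero>\<^bsub>P\<^esub>"
  by (rule ring_hom_zero[OF germ_hom ring_product ring_reduced_product, symmetric])

lemma reduced_product_one: "\<one>\<^bsub>reduced_product\<^esub> = germ \<one>\<^bsub>P\<^esub>"
  by (rule ring_hom_one[OF germ_hom, symmetric])

lemma germ_eq_zero_iff:
  assumes "x \<in> carrier P"
  shows "germ x = \<zero>\<^bsub>reduced_product\<^esub> \<longleftrightarrow> eventually (\<lambda>i. x i = \<zero>\<^bsub>S i\<^esub>) F"
proof -
  interpret P: ring P by (rule ring_product)
  show ?thesis
    unfolding reduced_product_zero germ_eq_iff[OF assms P.zero_closed]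
    by (rule eventually_cong[OF eventually_index]) simp
qed

text \<open>
  Components that are invertible almost everywhere can be inverted one by one, since nothing relates
  the components of a family to each other; where this fails, any value of the inverse will do.
\<close>

lemma germ_in_Units_iff:
  assumes x: "x \<in> carrier P"
  shows "germ x \<in> Units reduced_product \<longleftrightarrow> eventually (\<lambda>i. x i \<in> Units (S i)) F"
proof -
  interpret P: ring P by (rule ring_product)
  have inverse_iff: "germ x \<otimes>\<^bsub>reduced_product\<^esub> germ y = \<one>\<^bsub>reduced_product\<^esub> \<and>
      germ y \<otimes>\<^bsub>reduced_product\<^esub> germ x = \<one>\<^bsub>reduced_product\<^esub> \<longleftrightarrow>
      eventually (\<lambda>i. x i \<otimes>\<^bsub>S i\<^esub> y i = \<one>\<^bsub>S i\<^esub> \<and> y i \<otimes>\<^bsub>S i\<^esub> x i = \<one>\<^bsub>S i\<^esub>) F"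
    if y: "y \<in> carrier P" for y
  proof -
    have "eventually (\<lambda>i. (x \<otimes>\<^bsub>P\<^esub> y) i = \<one>\<^bsub>P\<^esub> i) F \<and> eventually (\<lambda>i. (y \<otimes>\<^bsub>P\<^esub> x) i = \<one>\<^bsub>P\<^esub> i) F \<longleftrightarrow>
      eventually (\<lambda>i. x i \<otimes>\<^bsub>S i\<^esub> y i = \<one>\<^bsub>S i\<^esub> \<and> y i \<otimes>\<^bsub>S i\<^esub> x i = \<one>\<^bsub>S i\<^esub>) F"
      unfolding eventually_conj_iff[symmetric]
      by (rule eventually_cong[OF eventually_index]) simp
    then show ?thesis
      unfolding reduced_product_one ring_hom_mult[OF germ_hom x y, symmetric]
        ring_hom_mult[OF germ_hom y x, symmetric] germ_eq_iff[OF P.m_closed[OF x y] P.one_closed]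
        germ_eq_iff[OF P.m_closed[OF y x] P.one_closed] .
  qed
  show ?thesis
  proof
    assume u: "germ x \<in> Units reduced_product"
    then obtain A where A: "A \<in> carrier reduced_product"
        "germ x \<otimes>\<^bsub>reduced_product\<^esub> A = \<one>\<^bsub>reduced_product\<^esub>"
        "A \<otimes>\<^bsub>reduced_product\<^esub> germ x = \<one>\<^bsub>reduced_product\<^esub>"
      unfolding Units_def by blast
    obtain y where y: "y \<in> carrier P" "A = germ y" by (rule germ_surj[OF A(1)])
    have "eventually (\<lambda>i. i \<in> I \<and> x i \<otimes>\<^bsub>S i\<^esub> y i = \<one>\<^bsub>S i\<^esub> \<and> y i \<otimes>\<^bsub>S i\<^esub> x i = \<one>\<^bsub>S i\<^esub>) F"
      using inverse_iff[OF y(1)] A(2,3) unfolding y(2)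
      by (intro eventually_conj[OF eventually_index]) blast
    then show "eventually (\<lambda>i. x i \<in> Units (S i)) F"
      by (rule eventually_mono) (use x y(1) in \<open>auto simp: Units_def PiE_iff\<close>)
  next
    assume u: "eventually (\<lambda>i. x i \<in> Units (S i)) F"
    define y where "y = (\<lambda>i\<in>I. if x i \<in> Units (S i) then inv\<^bsub>S i\<^esub> (x i) else \<zero>\<^bsub>S i\<^esub>)"
    have y: "y \<in> carrier P"
      by (auto simp: y_def monoid.Units_inv_closed[OF ring.is_monoid[OF ring_component]]
          ring.ring_simprules(2)[OF ring_component])
    have "eventually (\<lambda>i. x i \<otimes>\<^bsub>S i\<^esub> y i = \<one>\<^bsub>S i\<^esub> \<and> y i \<otimes>\<^bsub>S i\<^esub> x i = \<one>\<^bsub>S i\<^esub>) F"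
      using eventually_conj[OF eventually_index u]
      by (rule eventually_mono)
        (auto simp: y_def monoid.Units_l_inv[OF ring.is_monoid[OF ring_component]]
          monoid.Units_r_inv[OF ring.is_monoid[OF ring_component]])
    then have "germ x \<otimes>\<^bsub>reduced_product\<^esub> germ y = \<one>\<^bsub>reduced_product\<^esub>"
        "germ y \<otimes>\<^bsub>reduced_product\<^esub> germ x = \<one>\<^bsub>reduced_product\<^esub>"
      using inverse_iff[OF y] by blast+
    then show "germ x \<in> Units reduced_product"
      unfolding Units_def using ring_hom_closed[OF germ_hom] x y by blast
  qed
qed

lemma reduced_product_nonzero:
  assumes "\<And>i. i \<in> I \<Longrightarrow> nonzero_ring (S i)" and "F \<noteq> bot"
  shows "nonzero_ring reduced_product"
proof (intro nonzero_ring.intro nonzero_ring_axioms.intro ring_reduced_product notI)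
  interpret P: ring P by (rule ring_product)
  assume "\<one>\<^bsub>reduced_product\<^esub> = \<zero>\<^bsub>reduced_product\<^esub>"
  then have "eventually (\<lambda>i. \<one>\<^bsub>P\<^esub> i = \<zero>\<^bsub>S i\<^esub>) F"
    unfolding reduced_product_one germ_eq_zero_iff[OF P.one_closed] .
  with eventually_index have "eventually (\<lambda>i. False) F"
    by eventually_elim (simp add: nonzero_ring.one_not_zero[OF assms(1)])
  then show False using assms(2) by (simp add: eventually_False)
qed

end

section \<open>Pairs on a direct limit\<close>

context direct_system
begin

lemma Hom_map_cls_mu:
  assumes "i \<in> I" "j \<in> I" "leq i j"
  shows "Hom_map (R i) (\<mu> i j) (Hom_map (R j) (cls j) p) = Hom_map (R i) (cls i) p"
  unfolding Hom_map_def using mu_closed[OF assms] cls_mu[OF assms] by auto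

text \<open>
  Since \<open>L\<close> is the union of the images of the \<open>R i\<close>, a subset of \<open>L\<close> is contained in another
  one as soon as this holds for all preimages.
\<close>

lemma Hom_map_cls_le_iff:
  assumes "p \<in> carrier (Hom L)"
  shows "(\<forall>i\<in>I. Hom_map (R i) (cls i) p \<sqsubseteq>\<^bsub>Hom (R i)\<^esub> Hom_map (R i) (cls i) q) \<longleftrightarrow> p \<sqsubseteq>\<^bsub>Hom L\<^esub> q"
proof -
  have subset_iff: "(\<forall>i\<in>I. {r \<in> carrier (R i). cls i r \<in> A} \<subseteq> {r \<in> carrier (R i). cls i r \<in> B})
      \<longleftrightarrow> A \<subseteq> B" if "A \<subseteq> carrier L" for A B
    using that unfolding carrier_L by blast
  have "fst p \<subseteq> carrier L" "snd p \<subseteq> carrier L"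
    using assms by (auto simp: Hom_def Hom_carrier_def hom_pair_def a_kernel_def')
  then show ?thesis
    by (simp add: Hom_def Hom_map_def subset_iff[symmetric] ball_conj_distrib)
qed

definition tails :: "'i filter" where
  "tails = (INF k\<in>I. principal {j \<in> I. leq k j})"

lemma eventually_tails: "eventually Q tails \<longleftrightarrow> (\<exists>k\<in>I. \<forall>j\<in>I. leq k j \<longrightarrow> Q j)"
proof -
  have "\<exists>c\<in>I. principal {j \<in> I. leq c j} \<le> inf (principal {j \<in> I. leq a j}) (principal {j \<in> I. leq b j})"
    if ab: "a \<in> I" "b \<in> I" for a b
  proof -
    obtain c where "c \<in> I" "leq a c" "leq b c" using directed[OF ab] by blast
    then show ?thesis using ab by (auto intro!: bexI[of _ c] intro: leq_trans)
  qed
  then show ?thesis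
    unfolding tails_def by (subst eventually_INF_base) (auto simp: nonempty eventually_principal)
qed

lemma tails_nontrivial: "tails \<noteq> bot"
  unfolding trivial_limit_def eventually_tails using leq_refl by blast

text \<open>
  This turns compatibility into statements about germs: for an element of \<open>R i\<close> and a compatible
  family of pairs, membership of its image in the \<open>j\<close>-th component does not depend on \<open>j\<close> as long
  as \<open>j\<close> lies above \<open>i\<close>.
\<close>

lemma eventually_tails_constant:
  assumes i: "i \<in> I" and Q: "\<And>j. j \<in> I \<Longrightarrow> leq i j \<Longrightarrow> Q j \<longleftrightarrow> c"
  shows "eventually Q tails \<longleftrightarrow> c"
proof
  assume "eventually Q tails"
  then obtain k where k: "k \<in> I" "\<And>j. j \<in> I \<Longrightarrow> leq k j \<Longrightarrow> Q j"
    unfolding eventually_tails by blast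
  obtain n where "n \<in> I" "leq i n" "leq k n" using directed[OF i k(1)] by blast
  then show c using k(2) Q by blast
qed (use assms in \<open>auto simp: eventually_tails\<close>)

text \<open>
  The reduced product along the tails receives a morphism from \<open>L\<close> although the rings \<open>S i\<close> are
  not connected by any maps. It is not the zero ring because directedness makes the tails a proper
  filter, and \<open>hom_pair_in_Hom\<close> shows that the pair of a morphism into it belongs to \<open>Hom L\<close>
  although its elements have another type than the one in the definition of \<open>Hom\<close>.
\<close>

lemma compatible_family_realized:
  fixes S :: "'i \<Rightarrow> ('b, 'n) ring_scheme"
  assumes S: "\<And>i. i \<in> I \<Longrightarrow> nonzero_ring (S i)"
    and \<phi>: "\<And>i. i \<in> I \<Longrightarrow> \<phi> i \<in> ring_hom (R i) (S i)"
    and compatible: "\<And>i j. \<lbrakk>i \<in> I; j \<in> I; leq i j\<rbrakk> \<Longrightarrow>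
      Hom_map (R i) (\<mu> i j) (hom_pair (R j) (S j) (\<phi> j)) = hom_pair (R i) (S i) (\<phi> i)"
  shows "\<exists>p\<in>carrier (Hom L). \<forall>i\<in>I. Hom_map (R i) (cls i) p = hom_pair (R i) (S i) (\<phi> i)"
proof -
  interpret T: ring_family I S tails
  proof (rule ring_family.intro)
    show "ring (S i)" if "i \<in> I" for i by (rule nonzero_ring.axioms(1)[OF S[OF that]])
    show "eventually (\<lambda>i. i \<in> I) tails"
      unfolding tails_def using nonempty by (auto simp: eventually_principal intro: eventually_INF1)
  qed
  interpret P: ring T.P by (rule T.ring_product)
  \<comment> \<open>With the default value zero at the indices not above \<open>i\<close>, the identity is not
    preserved, but germs ignore these indices.\<close>
  define family where
    "family i r = (\<lambda>j\<in>I. if leq i j then \<phi> j (\<mu> i j r) else \<zero>\<^bsub>S j\<^esub>)" for i r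
  define g where "g i r = T.germ (family i r)" for i r
  have family_above: "family i r j = \<phi> j (\<mu> i j r)" if "j \<in> I" "leq i j" for i j r
    using that by (simp add: family_def)
  have family_closed: "family i r \<in> carrier T.P" if "i \<in> I" "r \<in> carrier (R i)" for i r
    using that by (auto simp: family_def ring.ring_simprules(2)[OF T.ring_component]
        intro!: ring_hom_closed[OF \<phi>] mu_closed)
  have germ_eqI: "T.germ x = T.germ y"
    if "x \<in> carrier T.P" "y \<in> carrier T.P" "i \<in> I" "\<And>j. j \<in> I \<Longrightarrow> leq i j \<Longrightarrow> x j = y j" for x y i
    using that T.germ_eq_iff eventually_tails by blast
  have g_hom: "g i \<in> ring_hom (R i) T.reduced_product" if i: "i \<in> I" for i
  proof (rule ring_hom_memI)
    interpret Ri: ring "R i" by (rule ring[OF i])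
    fix r assume r: "r \<in> carrier (R i)"
    show "g i r \<in> carrier T.reduced_product"
      unfolding g_def by (rule ring_hom_closed[OF T.germ_hom family_closed[OF i r]])
    fix s assume s: "s \<in> carrier (R i)"
    note fr = family_closed[OF i r] and fs = family_closed[OF i s]
    have step: "\<mu> i j r \<in> carrier (R j)" "\<mu> i j s \<in> carrier (R j)"
      "\<phi> j (\<mu> i j (r \<otimes>\<^bsub>R i\<^esub> s)) = \<phi> j (\<mu> i j r) \<otimes>\<^bsub>S j\<^esub> \<phi> j (\<mu> i j s)"
      "\<phi> j (\<mu> i j (r \<oplus>\<^bsub>R i\<^esub> s)) = \<phi> j (\<mu> i j r) \<oplus>\<^bsub>S j\<^esub> \<phi> j (\<mu> i j s)"
      if j: "j \<in> I" "leq i j" for j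
    proof -
      show cl: "\<mu> i j r \<in> carrier (R j)" "\<mu> i j s \<in> carrier (R j)"
        using mu_closed i j r s by blast+
      show "\<phi> j (\<mu> i j (r \<otimes>\<^bsub>R i\<^esub> s)) = \<phi> j (\<mu> i j r) \<otimes>\<^bsub>S j\<^esub> \<phi> j (\<mu> i j s)"
        unfolding ring_hom_mult[OF hom[OF i j] r s] by (rule ring_hom_mult[OF \<phi>[OF j(1)] cl])
      show "\<phi> j (\<mu> i j (r \<oplus>\<^bsub>R i\<^esub> s)) = \<phi> j (\<mu> i j r) \<oplus>\<^bsub>S j\<^esub> \<phi> j (\<mu> i j s)"
        unfolding ring_hom_add[OF hom[OF i j] r s] by (rule ring_hom_add[OF \<phi>[OF j(1)] cl])
    qed
    show "g i (r \<otimes>\<^bsub>R i\<^esub> s) = g i r \<otimes>\<^bsub>T.reduced_product\<^esub> g i s"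
      unfolding g_def ring_hom_mult[OF T.germ_hom fr fs, symmetric]
      by (rule germ_eqI[OF family_closed[OF i Ri.m_closed[OF r s]] P.m_closed[OF fr fs] i])
        (simp add: family_above step)
    show "g i (r \<oplus>\<^bsub>R i\<^esub> s) = g i r \<oplus>\<^bsub>T.reduced_product\<^esub> g i s"
      unfolding g_def ring_hom_add[OF T.germ_hom fr fs, symmetric]
      by (rule germ_eqI[OF family_closed[OF i Ri.a_closed[OF r s]] P.a_closed[OF fr fs] i])
        (simp add: family_above step)
  next
    interpret Ri: ring "R i" by (rule ring[OF i])
    show "g i \<one>\<^bsub>R i\<^esub> = \<one>\<^bsub>T.reduced_product\<^esub>"
      unfolding g_def T.reduced_product_one
      by (rule germ_eqI[OF family_closed[OF i Ri.one_closed] P.one_closed i])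
        (simp add: family_above ring_hom_one[OF hom[OF i]] ring_hom_one[OF \<phi>])
  qed
  have g_mu: "g j (\<mu> i j r) = g i r" if h: "i \<in> I" "j \<in> I" "leq i j" "r \<in> carrier (R i)" for i j r
    unfolding g_def
  proof (rule germ_eqI[OF family_closed[OF h(2) mu_closed[OF h]] family_closed[OF h(1,4)] h(2)])
    fix k assume k: "k \<in> I" "leq j k"
    have "leq i k" by (rule leq_trans[OF h(1,2) k(1) h(3) k(2)])
    then show "family j (\<mu> i j r) k = family i r k"
      using hom_comp[OF h(1,2) k(1) h(3) k(2) h(4)] k by (simp add: family_above)
  qed
  obtain h where h: "h \<in> ring_hom L T.reduced_product"
    and h_cls: "\<And>i r. i \<in> I \<Longrightarrow> r \<in> carrier (R i) \<Longrightarrow> h (cls i r) = g i r"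
    using direct_limit_universal[OF T.ring_reduced_product g_hom g_mu] by blast
  have pair_iff: "(\<phi> j (\<mu> i j r) = \<zero>\<^bsub>S j\<^esub> \<longleftrightarrow> \<phi> i r = \<zero>\<^bsub>S i\<^esub>) \<and>
      (\<phi> j (\<mu> i j r) \<in> Units (S j) \<longleftrightarrow> \<phi> i r \<in> Units (S i))"
    if "i \<in> I" "r \<in> carrier (R i)" "j \<in> I" "leq i j" for i j r
    using compatible[OF that(1,3,4)] mu_closed[OF that(1,3,4,2)] that(2)
    by (auto simp: Hom_map_def hom_pair_def a_kernel_def' set_eq_iff)
  have ker: "h (cls i r) = \<zero>\<^bsub>T.reduced_product\<^esub> \<longleftrightarrow> \<phi> i r = \<zero>\<^bsub>S i\<^esub>"
    if ir: "i \<in> I" "r \<in> carrier (R i)" for i r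
    unfolding h_cls[OF ir] g_def T.germ_eq_zero_iff[OF family_closed[OF ir]]
    by (rule eventually_tails_constant[OF ir(1)]) (simp add: family_above pair_iff[OF ir])
  have units: "h (cls i r) \<in> Units T.reduced_product \<longleftrightarrow> \<phi> i r \<in> Units (S i)"
    if ir: "i \<in> I" "r \<in> carrier (R i)" for i r
    unfolding h_cls[OF ir] g_def T.germ_in_Units_iff[OF family_closed[OF ir]]
    by (rule eventually_tails_constant[OF ir(1)]) (simp add: family_above pair_iff[OF ir])
  show ?thesis
  proof (intro bexI ballI)
    show "hom_pair L T.reduced_product h \<in> carrier (Hom L)"
      by (rule hom_pair_in_Hom[OF direct_limit_nonzero_ring
            T.reduced_product_nonzero[OF S tails_nontrivial] h])
    fix i assume i: "i \<in> I"
    show "Hom_map (R i) (cls i) (hom_pair L T.reduced_product h) = hom_pair (R i) (S i) (\<phi> i)"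
      unfolding Hom_map_def hom_pair_def a_kernel_def' fst_conv snd_conv
      using ker[OF i] units[OF i] cls_closed[OF i] by blast
  qed
qed

lemma Hom_direct_limit:
  "poset_isomorphic (Hom L) (inverse_limit I leq (\<lambda>i. Hom (R i)) (\<lambda>i j. Hom_map (R i) (\<mu> i j)))"
    (is "poset_isomorphic _ ?lim")
proof -
  define f where "f p = (\<lambda>i\<in>I. Hom_map (R i) (cls i) p)" for p
  have f_le: "p \<sqsubseteq>\<^bsub>Hom L\<^esub> q \<longleftrightarrow> f p \<sqsubseteq>\<^bsub>?lim\<^esub> f q"
    if "p \<in> carrier (Hom L)" for p q
    using Hom_map_cls_le_iff[OF that] by (simp add: inverse_limit_def f_def)
  have f_closed: "f p \<in> carrier ?lim" if p: "p \<in> carrier (Hom L)" for p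
    using Hom_map_closed[OF nonzero_ring direct_limit_cocone(1) p]
    by (auto simp: inverse_limit_def f_def Hom_map_cls_mu)
  have "inj_on f (carrier (Hom L))"
  proof (rule inj_onI)
    interpret H: partial_order "Hom L" by (rule Hom_partial_order)
    interpret Ri: partial_order "Hom (R i)" for i by (rule Hom_partial_order)
    fix p q assume pq: "p \<in> carrier (Hom L)" "q \<in> carrier (Hom L)" and eq: "f p = f q"
    have "f p \<sqsubseteq>\<^bsub>?lim\<^esub> f p" "f q \<sqsubseteq>\<^bsub>?lim\<^esub> f q"
      using pq f_le H.le_refl by blast+
    then have "p \<sqsubseteq>\<^bsub>Hom L\<^esub> q" "q \<sqsubseteq>\<^bsub>Hom L\<^esub> p" using f_le pq eq by simp_all
    then show "p = q" using pq H.le_antisym by (simp add: H.eq_is_equal)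
  qed
  moreover have "carrier ?lim \<subseteq> f ` carrier (Hom L)"
  proof
    fix x assume x: "x \<in> carrier ?lim"
    then have "\<forall>i\<in>I. \<exists>(S :: (bool \<times> 'a) list list ring) \<phi>.
        nonzero_ring S \<and> \<phi> \<in> ring_hom (R i) S \<and> x i = hom_pair (R i) S \<phi>"
      by (fastforce simp: inverse_limit_def PiE_iff Hom_def Hom_carrier_def)
    then obtain S :: "'i \<Rightarrow> (bool \<times> 'a) list list ring" and \<phi> where
      S: "\<And>i. i \<in> I \<Longrightarrow> nonzero_ring (S i)" "\<And>i. i \<in> I \<Longrightarrow> \<phi> i \<in> ring_hom (R i) (S i)"
        "\<And>i. i \<in> I \<Longrightarrow> x i = hom_pair (R i) (S i) (\<phi> i)"
      by metis
    have "Hom_map (R i) (\<mu> i j) (hom_pair (R j) (S j) (\<phi> j)) = hom_pair (R i) (S i) (\<phi> i)"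
      if "i \<in> I" "j \<in> I" "leq i j" for i j
      using x that by (simp add: inverse_limit_def S(3)[symmetric])
    from compatible_family_realized[OF S(1,2) this] obtain p where
      p: "p \<in> carrier (Hom L)" "\<forall>i\<in>I. Hom_map (R i) (cls i) p = x i"
      using S(3) by auto
    have "x \<in> extensional I" using x by (simp add: inverse_limit_def PiE_def)
    then have "x = f p" using p(2) by (auto simp: f_def extensional_def)
    then show "x \<in> f ` carrier (Hom L)" using p(1) by blast
  qed
  ultimately show ?thesis
    unfolding poset_isomorphic_def bij_betw_def using f_closed f_le by blast
qed

end

theorem theorem4p1:
  fixes I :: "'i set"
    and leq :: "'i \<Rightarrow> 'i \<Rightarrow> bool"
    and R :: "'i \<Rightarrow> ('a, 'm) ring_scheme"
    and \<mu> :: "'i \<Rightarrow> 'i \<Rightarrow> 'a \<Rightarrow> 'a"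
  assumes "direct_system I leq R \<mu>"
  shows "poset_isomorphic
           (Hom (direct_limit I leq R \<mu>))
           (inverse_limit I leq (\<lambda>i. Hom (R i)) (\<lambda>i j. Hom_map (R i) (\<mu> i j)))"
  using assms by (rule direct_system.Hom_direct_limit)

end
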